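(* Let $J$ be any almost complex structure on a $4$-dimensional smooth manifold $M$. Then for every point $x\in M$, $$\dim (\operatorname{Im} N^J)_x\le 2 .$$
   Context: An almost complex structure $J$ on $M$ is a smooth field of endomorphisms of $TM$ with $J^2=-\mathrm{Id}$. Its Nijenhuis tensor is the $(1,2)$-tensor $N^J(X,Y)=[JX,JY]-J[JX,Y]-J[X,JY]-[X,Y]$ for vector fields $X,Y$. For $x\in M$, $(\operatorname{Im} N^J)_x$ is the linear span in $T_xM$ of all the values $N^J_x(X,Y)$, $X,Y\in T_xM$. Dimensions are over $\mathbb{R}$. *)

theory Defs
  imports "HOL-Analysis.Analysis" "HOL-Library.Function_Algebras"
begin

text \<open>Pointwise vector space structure on functions; it is used for tangent vectors, which are
  encoded below as families of coordinate vectors indexed by charts.\<close>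

instantiation "fun" :: (type, real_vector) real_vector
begin

definition scaleR_fun :: "real \<Rightarrow> ('a \<Rightarrow> 'b) \<Rightarrow> 'a \<Rightarrow> 'b"
  where "scaleR_fun r f = (\<lambda>x. r *\<^sub>R f x)"

instance
  by standard
    (simp_all add: scaleR_fun_def fun_eq_iff scaleR_add_right scaleR_add_left)

end


text \<open>Both predicates are meant for open sets \<open>S\<close> only.  On finite-dimensional spaces they are the
  usual classes \<open>C\<^sup>k\<close> and \<open>C\<^sup>\<infinity>\<close>; they depend only on the values of \<open>f\<close> on \<open>S\<close>.\<close>

primrec Ck_on :: "nat \<Rightarrow> ('a::real_normed_vector \<Rightarrow> 'b::real_normed_vector) \<Rightarrow> 'a set \<Rightarrow> bool"
where
  "Ck_on 0 f S \<longleftrightarrow> continuous_on S f"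
| "Ck_on (Suc k) f S \<longleftrightarrow>
     f differentiable_on S \<and> (\<forall>v. Ck_on k (\<lambda>x. frechet_derivative f (at x) v) S)"

definition smooth_on :: "('a::real_normed_vector \<Rightarrow> 'b::real_normed_vector) \<Rightarrow> 'a set \<Rightarrow> bool"
  where "smooth_on f S \<longleftrightarrow> (\<forall>k. Ck_on k f S)"


text \<open>A chart is a pair \<open>(U, \<phi>)\<close>; the values of \<open>\<phi>\<close> outside \<open>U\<close> are irrelevant.\<close>

type_synonym ('a, 'e) chart = "'a set \<times> ('a \<Rightarrow> 'e)"

definition chart_inv :: "('a, 'e) chart \<Rightarrow> 'e \<Rightarrow> 'a"
  where "chart_inv c = inv_into (fst c) (snd c)"

definition transition :: "('a, 'e) chart \<Rightarrow> ('a, 'e) chart \<Rightarrow> 'e \<Rightarrow> 'e"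
  where "transition c d = snd d \<circ> chart_inv c"

text \<open>The atlas \<open>A\<close> need not be maximal.  The dimension of the manifold is \<open>DIM('e)\<close>.\<close>

locale smooth_manifold =
  fixes M :: "'a topology" and A :: "('a, 'e::euclidean_space) chart set"
  assumes Hausdorff: "Hausdorff_space M"
    and second_countable: "second_countable M"
    and covers: "(\<Union>c\<in>A. fst c) = topspace M"
    and open_domain: "c \<in> A \<Longrightarrow> openin M (fst c)"
    and open_image: "c \<in> A \<Longrightarrow> open (snd c ` fst c)"
    and homeomorphism: "c \<in> A \<Longrightarrow>
      homeomorphic_map (subtopology M (fst c)) (top_of_set (snd c ` fst c)) (snd c)"
    and compatible: "c \<in> A \<Longrightarrow> d \<in> A \<Longrightarrow>
      smooth_on (transition c d) (snd c ` (fst c \<inter> fst d))"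

definition charts_at :: "('a, 'e) chart set \<Rightarrow> 'a \<Rightarrow> ('a, 'e) chart set"
  where "charts_at A p = {c \<in> A. p \<in> fst c}"


text \<open>A tangent vector at \<open>p\<close> is the family of its coordinate vectors \<open>v c\<close> in all charts \<open>c\<close> around
  \<open>p\<close>, which transform into each other by the derivatives of the transition maps; the family is
  extended by \<open>0\<close> to the other charts.  Evaluation at any chart around \<open>p\<close> is a linear
  isomorphism from the tangent space onto the model space.\<close>

type_synonym ('a, 'e) tangent = "('a, 'e) chart \<Rightarrow> 'e"

definition tangent_space ::
    "('a, 'e::euclidean_space) chart set \<Rightarrow> 'a \<Rightarrow> ('a, 'e) tangent set"
  where "tangent_space A p =
    {v. (\<forall>c \<in> charts_at A p. \<forall>d \<in> charts_at A p.
           v d = frechet_derivative (transition c d) (at (snd c p)) (v c))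
      \<and> (\<forall>c. c \<notin> charts_at A p \<longrightarrow> v c = 0)}"

text \<open>The tangent vector at \<open>p\<close> with coordinates \<open>e\<close> in the chart \<open>c\<close>.  For the standard basis
  vectors \<open>e\<close> this is the coordinate frame of \<open>c\<close>.\<close>

definition coord_vector ::
    "('a, 'e::euclidean_space) chart set \<Rightarrow> ('a, 'e) chart \<Rightarrow> 'e \<Rightarrow> 'a \<Rightarrow> ('a, 'e) tangent"
  where "coord_vector A c e p =
    (\<lambda>d. if d \<in> charts_at A p
         then frechet_derivative (transition c d) (at (snd c p)) e else 0)"

definition field_rep :: "('a, 'e) chart \<Rightarrow> ('a \<Rightarrow> ('a, 'e) tangent) \<Rightarrow> 'e \<Rightarrow> 'e"
  where "field_rep c X = (\<lambda>y. X (chart_inv c y) c)"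

text \<open>Smooth vector fields on an open subset \<open>W\<close> of the manifold.\<close>

definition vector_field_on ::
    "('a, 'e::euclidean_space) chart set \<Rightarrow> 'a set \<Rightarrow> ('a \<Rightarrow> ('a, 'e) tangent) \<Rightarrow> bool"
  where "vector_field_on A W X \<longleftrightarrow>
    (\<forall>p\<in>W. X p \<in> tangent_space A p) \<and>
    (\<forall>c\<in>A. smooth_on (field_rep c X) (snd c ` (fst c \<inter> W)))"

text \<open>In coordinates, \<open>[X,Y] = DY X - DX Y\<close>, that is,
  \<open>[X,Y]\<^sup>i = (\<Sum>j. X\<^sup>j \<partial>\<^sub>j Y\<^sup>i - Y\<^sup>j \<partial>\<^sub>j X\<^sup>i)\<close>.\<close>

definition lie_bracket ::
    "('a, 'e::euclidean_space) chart set \<Rightarrow> ('a \<Rightarrow> ('a, 'e) tangent) \<Rightarrow> ('a \<Rightarrow> ('a, 'e) tangent)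
      \<Rightarrow> 'a \<Rightarrow> ('a, 'e) tangent"
  where "lie_bracket A X Y p =
    (\<lambda>c. if c \<in> charts_at A p
         then frechet_derivative (field_rep c Y) (at (snd c p)) (X p c)
            - frechet_derivative (field_rep c X) (at (snd c p)) (Y p c)
         else 0)"


text \<open>The last condition is smoothness of the coefficients of \<open>J\<close> with respect to the coordinate
  frame of every chart.\<close>

definition almost_complex_structure ::
    "'a topology \<Rightarrow> ('a, 'e::euclidean_space) chart set
      \<Rightarrow> ('a \<Rightarrow> ('a, 'e) tangent \<Rightarrow> ('a, 'e) tangent) \<Rightarrow> bool"
  where "almost_complex_structure M A J \<longleftrightarrow>
    (\<forall>p \<in> topspace M.
       (\<forall>v \<in> tangent_space A p. J p v \<in> tangent_space A p) \<and>
       (\<forall>u \<in> tangent_space A p. \<forall>v \<in> tangent_space A p. J p (u + v) = J p u + J p v) \<and>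
       (\<forall>r. \<forall>v \<in> tangent_space A p. J p (r *\<^sub>R v) = r *\<^sub>R J p v) \<and>
       (\<forall>v \<in> tangent_space A p. J p (J p v) = - v)) \<and>
    (\<forall>c \<in> A. \<forall>e. smooth_on (field_rep c (\<lambda>p. J p (coord_vector A c e p))) (snd c ` fst c))"

definition nijenhuis ::
    "('a, 'e::euclidean_space) chart set \<Rightarrow> ('a \<Rightarrow> ('a, 'e) tangent \<Rightarrow> ('a, 'e) tangent)
      \<Rightarrow> ('a \<Rightarrow> ('a, 'e) tangent) \<Rightarrow> ('a \<Rightarrow> ('a, 'e) tangent) \<Rightarrow> 'a \<Rightarrow> ('a, 'e) tangent"
  where "nijenhuis A J X Y p =
    (let JX = (\<lambda>q. J q (X q)); JY = (\<lambda>q. J q (Y q)) in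
       lie_bracket A JX JY p - J p (lie_bracket A JX Y p) - J p (lie_bracket A X JY p)
       - lie_bracket A X Y p)"

text \<open>The value of the Nijenhuis tensor on tangent vectors \<open>u\<close>, \<open>v\<close> at \<open>x\<close> is \<open>nijenhuis A J X Y x\<close>
  for vector fields \<open>X\<close>, \<open>Y\<close> with \<open>X x = u\<close> and \<open>Y x = v\<close>.  Fields on arbitrary open neighbourhoods
  of \<open>x\<close> are allowed, so that every tangent vector visibly extends (with constant coordinates in a
  chart); global fields are the case \<open>W = topspace M\<close>.\<close>

definition nijenhuis_image ::
    "'a topology \<Rightarrow> ('a, 'e::euclidean_space) chart set
      \<Rightarrow> ('a \<Rightarrow> ('a, 'e) tangent \<Rightarrow> ('a, 'e) tangent) \<Rightarrow> 'a \<Rightarrow> ('a, 'e) tangent set"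
  where "nijenhuis_image M A J x =
    span {nijenhuis A J X Y x | X Y W.
            openin M W \<and> x \<in> W \<and> vector_field_on A W X \<and> vector_field_on A W Y}"

end

theory Submission
  imports Defs
begin

text \<open>
  In a chart, with \<open>D\<^sub>w\<close> denoting the derivative in direction \<open>w\<close>, one has
  \<open>N(u,v) = (D\<^bsub>Ju\<^esub>J)v - (D\<^bsub>Jv\<^esub>J)u + J(D\<^sub>vJ)u - J(D\<^sub>uJ)v\<close>, so \<open>N\<close> is bilinear and alternating, and
  differentiating \<open>J\<^sup>2 = -1\<close> gives \<open>N(Ju,v) = -J N(u,v)\<close>.  In real dimension 4 the tangent space
  has a basis \<open>a, Ja, b, Jb\<close>, hence all values of \<open>N\<close> lie in the span of \<open>N(a,b)\<close> and \<open>J N(a,b)\<close>.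
\<close>

subsection \<open>Second derivatives and families of linear maps\<close>

lemma has_real_derivative_along_line:
  fixes f :: "'a::real_normed_vector \<Rightarrow> real"
  assumes "(f has_derivative f') (at (a + s *\<^sub>R u))"
  shows "((\<lambda>t. f (a + t *\<^sub>R u)) has_real_derivative f' u) (at s)"
proof -
  interpret f': bounded_linear f' using assms by (rule has_derivative_bounded_linear)
  have "((\<lambda>t. a + t *\<^sub>R u) has_derivative (\<lambda>h. h *\<^sub>R u)) (at s)"
    by (auto intro!: derivative_eq_intros)
  from has_derivative_compose[OF this assms]
  show ?thesis
    unfolding has_field_derivative_def by (simp add: f'.scaleR mult.commute[of _ "f' u"])
qed

text \<open>Two applications of the mean value theorem, first along \<open>u\<close> and then along
  \<open>v\<close>. The bound on \<open>t\<close> keeps the whole parallelogram at \<open>y\<close>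
  inside the ball. The left side is symmetric in \<open>u\<close> and \<open>v\<close>, which is
  what makes it useful.\<close>

lemma second_difference_mean_value:
  fixes f :: "'a::real_normed_vector \<Rightarrow> real"
  assumes f: "\<And>x. x \<in> ball y r \<Longrightarrow> (f has_derivative f' x) (at x)"
    and f'u: "\<And>x. x \<in> ball y r \<Longrightarrow> ((\<lambda>x. f' x u) has_derivative D x) (at x)"
    and t: "t > 0" "t * (norm u + norm v) < r"
  obtains z where "z \<in> ball y r"
    "f (y + t *\<^sub>R u + t *\<^sub>R v) - f (y + t *\<^sub>R u) - f (y + t *\<^sub>R v) + f y = t\<^sup>2 * D z v"
proof -
  have in_ball: "y + s *\<^sub>R u + q *\<^sub>R v \<in> ball y r" if "0 \<le> s" "s \<le> t" "0 \<le> q" "q \<le> t" for s q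
  proof -
    have "norm (s *\<^sub>R u + q *\<^sub>R v) \<le> s * norm u + q * norm v"
      using that by (metis abs_of_nonneg norm_scaleR norm_triangle_ineq)
    also have "\<dots> \<le> t * norm u + t * norm v"
      using that by (intro add_mono mult_right_mono) auto
    finally have "norm (s *\<^sub>R u + q *\<^sub>R v) < r"
      using t(2) by (simp add: algebra_simps)
    moreover have "y - (y + s *\<^sub>R u + q *\<^sub>R v) = - (s *\<^sub>R u + q *\<^sub>R v)" by simp
    ultimately show ?thesis by (simp only: mem_ball dist_norm norm_minus_cancel)
  qed
  have in_ball0: "y + s *\<^sub>R u \<in> ball y r" if "0 \<le> s" "s \<le> t" for s
    using in_ball[OF that, of 0] t by simp
  \<comment> \<open>The function of \<open>q\<close> here is the increment of \<open>f\<close>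
    between two parallel segments in direction \<open>u\<close>, offset by
    \<open>t *\<^sub>R v\<close>.\<close>
  have "\<exists>s>0. s < t \<and> (f (y + t *\<^sub>R v + t *\<^sub>R u) - f (y + t *\<^sub>R u)) - (f (y + t *\<^sub>R v + 0 *\<^sub>R u) - f (y + 0 *\<^sub>R u))
      = (t - 0) * (f' (y + t *\<^sub>R v + s *\<^sub>R u) u - f' (y + s *\<^sub>R u) u)"
  proof (rule MVT2)
    fix q assume q: "0 \<le> q" "q \<le> t"
    have "y + t *\<^sub>R v + q *\<^sub>R u \<in> ball y r"
      using in_ball[OF q, of t] t by (simp add: add_ac)
    then show "((\<lambda>q. f (y + t *\<^sub>R v + q *\<^sub>R u) - f (y + q *\<^sub>R u)) has_real_derivative
        f' (y + t *\<^sub>R v + q *\<^sub>R u) u - f' (y + q *\<^sub>R u) u) (at q)"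
      by (intro DERIV_diff has_real_derivative_along_line f in_ball0 q)
  qed (rule t)
  then obtain s where s: "0 < s" "s < t" and 1:
    "f (y + t *\<^sub>R u + t *\<^sub>R v) - f (y + t *\<^sub>R u) - f (y + t *\<^sub>R v) + f y
      = t * (f' (y + s *\<^sub>R u + t *\<^sub>R v) u - f' (y + s *\<^sub>R u) u)"
    by (auto simp: algebra_simps)
  have "\<exists>q>0. q < t \<and> f' (y + s *\<^sub>R u + t *\<^sub>R v) u - f' (y + s *\<^sub>R u + 0 *\<^sub>R v) u
      = (t - 0) * D (y + s *\<^sub>R u + q *\<^sub>R v) v"
  proof (rule MVT2)
    fix q assume q: "0 \<le> q" "q \<le> t"
    show "((\<lambda>q. f' (y + s *\<^sub>R u + q *\<^sub>R v) u) has_real_derivative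
        D (y + s *\<^sub>R u + q *\<^sub>R v) v) (at q)"
      by (rule has_real_derivative_along_line[where f = "\<lambda>x. f' x u"])
        (use in_ball f'u s q in auto)
  qed (rule t)
  then obtain q where "0 < q" "q < t" and 2: "f' (y + s *\<^sub>R u + t *\<^sub>R v) u - f' (y + s *\<^sub>R u) u
      = t * D (y + s *\<^sub>R u + q *\<^sub>R v) v" by auto
  show thesis
  proof (rule that)
    show "y + s *\<^sub>R u + q *\<^sub>R v \<in> ball y r"
      using in_ball s \<open>0 < q\<close> \<open>q < t\<close> by simp
  qed (use 1 2 in \<open>simp add: power2_eq_square\<close>)
qed

text \<open>Schwarz's theorem. Exchanging \<open>u\<close> and \<open>v\<close> leaves the second
  difference unchanged, so the two mixed derivatives take a common value at points \<open>z\<close>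
  and \<open>w\<close> arbitrarily close to \<open>y\<close>; continuity then excludes a gap at
  \<open>y\<close>.\<close>

lemma symmetric_second_derivative_real:
  fixes f :: "'a::real_normed_vector \<Rightarrow> real"
  assumes S: "open S" "y \<in> S"
    and f: "\<And>x. x \<in> S \<Longrightarrow> (f has_derivative f' x) (at x)"
    and u: "\<And>x. x \<in> S \<Longrightarrow> ((\<lambda>x. f' x u) has_derivative Du x) (at x)"
    and v: "\<And>x. x \<in> S \<Longrightarrow> ((\<lambda>x. f' x v) has_derivative Dv x) (at x)"
    and cu: "continuous_on S (\<lambda>x. Du x v)" and cv: "continuous_on S (\<lambda>x. Dv x u)"
  shows "Du y v = Dv y u"
proof (rule ccontr)
  assume ne: "Du y v \<noteq> Dv y u"
  \<comment> \<open>Half the gap, so that two errors below \<open>e\<close> cannot add up to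
    it.\<close>
  define e where "e = \<bar>Du y v - Dv y u\<bar> / 2"
  have e: "e > 0" using ne by (simp add: e_def)
  have "isCont (\<lambda>x. Du x v) y" "isCont (\<lambda>x. Dv x u) y"
    using cu cv S by (auto simp: continuous_on_eq_continuous_at)
  then obtain r1 r2 where r12: "r1 > 0" "r2 > 0"
    "\<And>x. dist x y < r1 \<Longrightarrow> dist (Du x v) (Du y v) < e" "\<And>x. dist x y < r2 \<Longrightarrow> dist (Dv x u) (Dv y u) < e"
    using e unfolding continuous_at_eps_delta by metis
  obtain r0 where r0: "r0 > 0" "ball y r0 \<subseteq> S" using S by (meson openE)
  define r where "r = min r0 (min r1 r2)"
  have r: "r > 0" "ball y r \<subseteq> S" using r0 r12 by (auto simp: r_def)
  \<comment> \<open>This size gives \<open>t * (norm u + norm v) \<le> r / 2\<close>; the summand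
    \<open>1\<close> keeps the denominator positive when \<open>u\<close> and \<open>v\<close> both
    vanish.\<close>
  define t where "t = r / (2 * (norm u + norm v + 1))"
  have pos: "norm u + norm v + 1 > 0" by (smt (verit) norm_ge_zero)
  have t: "t > 0" using r pos by (simp add: t_def)
  have "t * (norm u + norm v) \<le> t * (norm u + norm v + 1)" using t by simp
  also have "\<dots> = r / 2" using pos by (simp add: t_def field_simps)
  finally have t2: "t * (norm u + norm v) < r" using r by simp
  obtain z where z: "z \<in> ball y r"
    "f (y + t *\<^sub>R u + t *\<^sub>R v) - f (y + t *\<^sub>R u) - f (y + t *\<^sub>R v) + f y = t\<^sup>2 * Du z v"
    using second_difference_mean_value[of y r f f' u Du t v] f u r t t2 by blast
  obtain w where w: "w \<in> ball y r"
    "f (y + t *\<^sub>R v + t *\<^sub>R u) - f (y + t *\<^sub>R v) - f (y + t *\<^sub>R u) + f y = t\<^sup>2 * Dv w u"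
    using second_difference_mean_value[of y r f f' v Dv t u] f v r t t2
    by (metis add.commute subsetD)
  have "t\<^sup>2 * Du z v = t\<^sup>2 * Dv w u"
    using z(2) w(2) by (simp add: algebra_simps)
  then have "Du z v = Dv w u" using t by simp
  moreover have "\<bar>Du z v - Du y v\<bar> < e" "\<bar>Dv w u - Dv y u\<bar> < e"
    using r12(3)[of z] r12(4)[of w] z(1) w(1) by (auto simp: r_def dist_commute[of y] dist_real_def)
  ultimately have "\<bar>Du y v - Dv y u\<bar> < e + e" by linarith
  then show False by (simp add: e_def)
qed

lemma symmetric_second_derivative:
  fixes f :: "'a::real_normed_vector \<Rightarrow> 'b::real_inner"
  assumes S: "open S" "y \<in> S"
    and f: "\<And>x. x \<in> S \<Longrightarrow> (f has_derivative f' x) (at x)"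
    and u: "\<And>x. x \<in> S \<Longrightarrow> ((\<lambda>x. f' x u) has_derivative Du x) (at x)"
    and v: "\<And>x. x \<in> S \<Longrightarrow> ((\<lambda>x. f' x v) has_derivative Dv x) (at x)"
    and cu: "continuous_on S (\<lambda>x. Du x v)" and cv: "continuous_on S (\<lambda>x. Dv x u)"
  shows "Du y v = Dv y u"
proof -
  \<comment> \<open>Pairing with the difference itself reduces to real values: the scalar case
    yields \<open>b \<bullet> b = 0\<close>.\<close>
  define b where "b = Du y v - Dv y u"
  have "Du y v \<bullet> b = Dv y u \<bullet> b"
    by (rule symmetric_second_derivative_real[OF S, where f = "\<lambda>x. f x \<bullet> b" and f' = "\<lambda>x h. f' x h \<bullet> b"
          and Du = "\<lambda>x h. Du x h \<bullet> b" and Dv = "\<lambda>x h. Dv x h \<bullet> b"])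
      (auto intro!: has_derivative_inner_left f u v continuous_on_inner cu cv)
  then have "b \<bullet> b = 0" by (simp add: b_def inner_diff_left)
  then show ?thesis by (simp add: b_def)
qed

section \<open>Smooth functions on open sets\<close>

lemma smooth_on_differentiable:
  assumes "smooth_on f S" "open S" "x \<in> S"
  shows "f differentiable (at x)"
proof -
  have "Ck_on 1 f S" using assms by (simp add: smooth_on_def)
  then show ?thesis using assms by (simp add: differentiable_on_eq_differentiable_at)
qed

lemma smooth_on_derivative:
  assumes "smooth_on f S"
  shows "smooth_on (\<lambda>x. frechet_derivative f (at x) v) S"
  using assms Ck_on.simps(2) unfolding smooth_on_def by blast

lemma smooth_on_continuous_on: "smooth_on f S \<Longrightarrow> continuous_on S f"
  using Ck_on.simps(1) unfolding smooth_on_def by blast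

lemma smooth_on_symmetric_derivative:
  fixes f :: "'a::real_normed_vector \<Rightarrow> 'b::real_inner"
  assumes sm: "smooth_on f S" and S: "open S" "y \<in> S"
  shows "frechet_derivative (\<lambda>x. frechet_derivative f (at x) u) (at y) v
       = frechet_derivative (\<lambda>x. frechet_derivative f (at x) v) (at y) u"
  by (rule symmetric_second_derivative[OF S, where f = f and f' = "\<lambda>x. frechet_derivative f (at x)"])
    (auto intro!: smooth_on_continuous_on smooth_on_derivative sm smooth_on_differentiable[OF _ S(1)]
       simp: frechet_derivative_works[symmetric])

lemma Ck_on_subset: "Ck_on k f S \<Longrightarrow> T \<subseteq> S \<Longrightarrow> Ck_on k f T"
  by (induction k arbitrary: f) (auto intro: continuous_on_subset differentiable_on_subset)

lemma smooth_on_subset: "smooth_on f S \<Longrightarrow> T \<subseteq> S \<Longrightarrow> smooth_on f T"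
  unfolding smooth_on_def using Ck_on_subset by blast

section \<open>Differentiation of linear maps depending on a point\<close>

lemma linear_expansion:
  fixes v :: "'a::euclidean_space"
  assumes "linear f"
  shows "f v = (\<Sum>b\<in>Basis. (v \<bullet> b) *\<^sub>R f b)"
proof -
  have "f v = f (\<Sum>b\<in>Basis. (v \<bullet> b) *\<^sub>R b)" by (simp add: euclidean_representation)
  then show ?thesis by (simp add: linear_sum[OF assms] linear_cmul[OF assms])
qed

text \<open>For linear \<open>F x\<close> the sum is the basis expansion of
  \<open>F x (Z x)\<close>. It is a finite sum of scalars times vectors, so the ordinary product
  rule applies.\<close>

lemma has_derivative_sum_basis:
  fixes F :: "'a::real_normed_vector \<Rightarrow> 'b::euclidean_space \<Rightarrow> 'c::real_normed_vector"
  assumes F: "\<And>b. (\<lambda>x. F x b) differentiable (at y)" and Z: "Z differentiable (at y)"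
  shows "((\<lambda>x. \<Sum>b\<in>Basis. (Z x \<bullet> b) *\<^sub>R F x b) has_derivative
      (\<lambda>w. \<Sum>b\<in>Basis. (Z y \<bullet> b) *\<^sub>R frechet_derivative (\<lambda>x. F x b) (at y) w
         + (frechet_derivative Z (at y) w \<bullet> b) *\<^sub>R F y b)) (at y)"
proof -
  have Fd: "((\<lambda>x. F x b) has_derivative frechet_derivative (\<lambda>x. F x b) (at y)) (at y)" for b
    using F frechet_derivative_works by blast
  have Zd: "(Z has_derivative frechet_derivative Z (at y)) (at y)"
    using Z frechet_derivative_works by blast
  show ?thesis
    by (intro has_derivative_sum has_derivative_scaleR has_derivative_inner_left Fd Zd)
qed

lemma frechet_derivative_linear_family:
  fixes F :: "'a::real_normed_vector \<Rightarrow> 'b::euclidean_space \<Rightarrow> 'c::real_normed_vector"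
  assumes S: "open S" "y \<in> S" and lin: "\<And>x. x \<in> S \<Longrightarrow> linear (F x)"
    and F: "\<And>b. (\<lambda>x. F x b) differentiable (at y)"
  shows "frechet_derivative (\<lambda>x. F x v) (at y) w
       = (\<Sum>b\<in>Basis. (v \<bullet> b) *\<^sub>R frechet_derivative (\<lambda>x. F x b) (at y) w)"
proof -
  have "((\<lambda>x. \<Sum>b\<in>Basis. (v \<bullet> b) *\<^sub>R F x b) has_derivative
      (\<lambda>w. \<Sum>b\<in>Basis. (v \<bullet> b) *\<^sub>R frechet_derivative (\<lambda>x. F x b) (at y) w)) (at y)"
    using has_derivative_sum_basis[of F y "\<lambda>_. v"] F by simp
  then have "((\<lambda>x. F x v) has_derivative
      (\<lambda>w. \<Sum>b\<in>Basis. (v \<bullet> b) *\<^sub>R frechet_derivative (\<lambda>x. F x b) (at y) w)) (at y)"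
    by (rule has_derivative_transform_within_open[OF _ S]) (simp add: linear_expansion[OF lin, symmetric])
  from frechet_derivative_at[OF this, symmetric] show ?thesis by (rule fun_cong)
qed

lemma linear_frechet_derivative_family:
  fixes F :: "'a::real_normed_vector \<Rightarrow> 'b::euclidean_space \<Rightarrow> 'c::real_normed_vector"
  assumes S: "open S" "y \<in> S" and lin: "\<And>x. x \<in> S \<Longrightarrow> linear (F x)"
    and F: "\<And>b. (\<lambda>x. F x b) differentiable (at y)"
  shows "linear (\<lambda>v. frechet_derivative (\<lambda>x. F x v) (at y) w)"
proof -
  have eq: "(\<lambda>v. frechet_derivative (\<lambda>x. F x v) (at y) w)
      = (\<lambda>v. \<Sum>b\<in>Basis. (v \<bullet> b) *\<^sub>R frechet_derivative (\<lambda>x. F x b) (at y) w)"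
    by (rule ext, rule frechet_derivative_linear_family[OF assms])
  show ?thesis
    unfolding eq by (rule linearI) (simp_all add: inner_add_left scaleR_add_left sum.distrib scaleR_sum_right)
qed

text \<open>The Leibniz rule for evaluating a variable linear map at a variable vector. It serves
  twice: for the derivative of a transition map applied to a field, and for \<open>J\<close> applied
  to a field.\<close>

lemma has_derivative_linear_family:
  fixes F :: "'a::real_normed_vector \<Rightarrow> 'b::euclidean_space \<Rightarrow> 'c::real_normed_vector"
  assumes S: "open S" "y \<in> S" and lin: "\<And>x. x \<in> S \<Longrightarrow> linear (F x)"
    and F: "\<And>b. (\<lambda>x. F x b) differentiable (at y)" and Z: "Z differentiable (at y)"
  shows "((\<lambda>x. F x (Z x)) has_derivative
      (\<lambda>w. frechet_derivative (\<lambda>x. F x (Z y)) (at y) w + F y (frechet_derivative Z (at y) w))) (at y)"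
proof -
  have eq: "(\<lambda>w. frechet_derivative (\<lambda>x. F x (Z y)) (at y) w + F y (frechet_derivative Z (at y) w))
    = (\<lambda>w. \<Sum>b\<in>Basis. (Z y \<bullet> b) *\<^sub>R frechet_derivative (\<lambda>x. F x b) (at y) w
         + (frechet_derivative Z (at y) w \<bullet> b) *\<^sub>R F y b)"
    unfolding sum.distrib
    by (intro ext arg_cong2[where f = plus] frechet_derivative_linear_family[OF S lin F]
        linear_expansion[OF lin[OF S(2)]])
  show ?thesis unfolding eq
    by (rule has_derivative_transform_within_open[OF has_derivative_sum_basis[OF F Z] S])
      (simp add: linear_expansion[OF lin, symmetric])
qed

lemma frechet_derivative_cong_open:
  assumes "open S" "x \<in> S" "\<And>y. y \<in> S \<Longrightarrow> f y = g y"
  shows "frechet_derivative f (at x) = frechet_derivative g (at x)"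
proof -
  have "(f has_derivative D) (at x) \<longleftrightarrow> (g has_derivative D) (at x)" for D
    using assms has_derivative_transform_within_open[OF _ assms(1,2)] by metis
  then show ?thesis by (simp add: frechet_derivative_def)
qed

text \<open>The second derivatives of \<open>\<tau>\<close> cancel by symmetry.  This matters because \<open>J\<close> is only
  constrained on tangent vectors, so that brackets must be known to be tangent before \<open>J\<close> is
  applied to them.\<close>

lemma bracket_transform:
  fixes \<tau> :: "'e::euclidean_space \<Rightarrow> 'f::real_inner"
  assumes \<tau>: "smooth_on \<tau> S" and S: "open S" "y \<in> S"
    and X: "X differentiable (at y)" "X' differentiable (at (\<tau> y))"
      "\<And>z. z \<in> S \<Longrightarrow> X' (\<tau> z) = frechet_derivative \<tau> (at z) (X z)"
    and Y: "Y differentiable (at y)" "Y' differentiable (at (\<tau> y))"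
      "\<And>z. z \<in> S \<Longrightarrow> Y' (\<tau> z) = frechet_derivative \<tau> (at z) (Y z)"
  shows "frechet_derivative Y' (at (\<tau> y)) (X' (\<tau> y)) - frechet_derivative X' (at (\<tau> y)) (Y' (\<tau> y))
    = frechet_derivative \<tau> (at y) (frechet_derivative Y (at y) (X y) - frechet_derivative X (at y) (Y y))"
proof -
  have diff: "\<tau> differentiable (at z)" if "z \<in> S" for z
    using smooth_on_differentiable[OF \<tau> S(1) that] .
  have lin: "linear (frechet_derivative \<tau> (at z))" if "z \<in> S" for z
    by (rule linear_frechet_derivative[OF diff[OF that]])
  have diff2: "(\<lambda>z. frechet_derivative \<tau> (at z) b) differentiable (at y)" for b
    by (rule smooth_on_differentiable[OF smooth_on_derivative[OF \<tau>] S])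
  \<comment> \<open>The function \<open>Z' \<circ> \<tau>\<close> is differentiated in two ways, by
    the chain rule and by the Leibniz rule. The first summand on the right is a second derivative of
    \<open>\<tau>\<close>, symmetric in \<open>w\<close> and \<open>Z y\<close>.\<close>
  have push: "frechet_derivative Z' (at (\<tau> y)) (frechet_derivative \<tau> (at y) w)
      = frechet_derivative (\<lambda>z. frechet_derivative \<tau> (at z) (Z y)) (at y) w
        + frechet_derivative \<tau> (at y) (frechet_derivative Z (at y) w)"
    if Z: "Z differentiable (at y)" "Z' differentiable (at (\<tau> y))"
      "\<And>z. z \<in> S \<Longrightarrow> Z' (\<tau> z) = frechet_derivative \<tau> (at z) (Z z)"
    for Z :: "'e \<Rightarrow> 'e" and Z' :: "'f \<Rightarrow> 'f" and w
  proof -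
    have "((\<lambda>z. Z' (\<tau> z)) has_derivative
        (\<lambda>w. frechet_derivative Z' (at (\<tau> y)) (frechet_derivative \<tau> (at y) w))) (at y)"
      by (rule has_derivative_compose[OF frechet_derivative_works[THEN iffD1, OF diff[OF S(2)]]
            frechet_derivative_works[THEN iffD1, OF Z(2)]])
    then have "((\<lambda>z. frechet_derivative \<tau> (at z) (Z z)) has_derivative
        (\<lambda>w. frechet_derivative Z' (at (\<tau> y)) (frechet_derivative \<tau> (at y) w))) (at y)"
      by (rule has_derivative_transform_within_open[OF _ S]) (rule Z(3))
    from has_derivative_unique[OF this has_derivative_linear_family[OF S lin diff2 Z(1)]]
    show ?thesis by meson
  qed
  show ?thesis
    using push[OF X, of "Y y"] push[OF Y, of "X y"] S(2)
      smooth_on_symmetric_derivative[OF \<tau> S, of "X y" "Y y"]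
    by (simp add: X(3) Y(3) linear_diff[OF lin[OF S(2)]])
qed

subsection \<open>The Nijenhuis tensor in coordinates\<close>

text \<open>The local model of an almost complex structure: a chart identifies all tangent spaces
  with the model space. First derivatives of \<open>K\<close> suffice, since the Nijenhuis tensor
  involves no higher ones.\<close>

locale almost_complex_family =
  fixes K :: "'e::euclidean_space \<Rightarrow> 'e \<Rightarrow> 'e" and S :: "'e set"
  assumes open_S: "open S"
    and linear_K: "x \<in> S \<Longrightarrow> linear (K x)"
    and K_K: "x \<in> S \<Longrightarrow> K x (K x v) = - v"
    and differentiable_K: "x \<in> S \<Longrightarrow> (\<lambda>x. K x v) differentiable (at x)"
begin

definition dK :: "'e \<Rightarrow> 'e \<Rightarrow> 'e \<Rightarrow> 'e"
  where "dK x w v = frechet_derivative (\<lambda>x. K x v) (at x) w"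

text \<open>What remains of the bracket formula once the derivatives of the two fields have
  cancelled; see \<open>nijenhuis_coord_eq\<close>.\<close>

definition nijenhuis_coord :: "'e \<Rightarrow> 'e \<Rightarrow> 'e \<Rightarrow> 'e"
  where "nijenhuis_coord x u v =
    dK x (K x u) v - dK x (K x v) u + K x (dK x v u) - K x (dK x u v)"

lemma linear_dK_left: "x \<in> S \<Longrightarrow> linear (\<lambda>w. dK x w v)"
  unfolding dK_def by (rule linear_frechet_derivative[OF differentiable_K])

lemma linear_dK_right: "x \<in> S \<Longrightarrow> linear (dK x w)"
  unfolding dK_def[abs_def]
  by (rule linear_frechet_derivative_family[OF open_S _ linear_K differentiable_K])

lemma has_derivative_K:
  assumes "x \<in> S" "Z differentiable (at x)"
  shows "((\<lambda>y. K y (Z y)) has_derivative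
    (\<lambda>w. dK x w (Z x) + K x (frechet_derivative Z (at x) w))) (at x)"
  unfolding dK_def
  by (rule has_derivative_linear_family[OF open_S assms(1) linear_K differentiable_K[OF assms(1)] assms(2)])

text \<open>Differentiate the constant \<open>K y (K y v) = - v\<close> by the Leibniz rule, with
  the field \<open>K y v\<close> in the inner position.\<close>

lemma dK_K:
  assumes x: "x \<in> S"
  shows "dK x w (K x v) = - K x (dK x w v)"
proof -
  have "((\<lambda>y. - v) has_derivative
      (\<lambda>w. dK x w (K x v) + K x (frechet_derivative (\<lambda>y. K y v) (at x) w))) (at x)"
    by (rule has_derivative_transform_within_open[OF has_derivative_K[OF x differentiable_K[OF x]] open_S x])
      (rule K_K)
  from has_derivative_unique[OF this has_derivative_const]
  have "dK x w (K x v) + K x (frechet_derivative (\<lambda>y. K y v) (at x) w) = 0" by meson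
  then show ?thesis by (simp add: dK_def eq_neg_iff_add_eq_0)
qed

lemma linear_nijenhuis_coord:
  assumes x: "x \<in> S"
  shows "linear (nijenhuis_coord x u)" "linear (\<lambda>u. nijenhuis_coord x u v)"
  unfolding nijenhuis_coord_def[abs_def]
  using linear_dK_left[OF x] linear_dK_right[OF x] linear_K[OF x]
  by (auto intro!: linear_compose_add linear_compose_sub linear_compose[unfolded o_def, of _ "K x"]
      linear_compose[unfolded o_def, of "K x" "\<lambda>w. dK x w _"])

lemma nijenhuis_coord_self: "nijenhuis_coord x u u = 0"
  by (simp add: nijenhuis_coord_def)

text \<open>By \<open>dK_K\<close> and \<open>K_K\<close> the terms on both sides match: the first
  and the fourth term of the definition exchange roles, the second and the third keep
  theirs.\<close>

lemma nijenhuis_coord_K: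
  assumes x: "x \<in> S"
  shows "nijenhuis_coord x (K x u) v = - K x (nijenhuis_coord x u v)"
  by (simp add: nijenhuis_coord_def dK_K[OF x] K_K[OF x] linear_neg[OF linear_dK_left[OF x]]
      linear_neg[OF linear_K[OF x]] linear_add[OF linear_K[OF x]] linear_diff[OF linear_K[OF x]])

text \<open>Tensoriality. The Leibniz rule splits the derivatives of \<open>JX\<close> and
  \<open>JY\<close>; by \<open>K_K\<close> all terms with derivatives of \<open>X\<close> or
  \<open>Y\<close> cancel in pairs, so only the values at \<open>x\<close> matter.\<close>

lemma nijenhuis_coord_eq:
  assumes x: "x \<in> S" and X: "X differentiable (at x)" and Y: "Y differentiable (at x)"
  defines "JX \<equiv> \<lambda>y. K y (X y)" and "JY \<equiv> \<lambda>y. K y (Y y)"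
  shows "(frechet_derivative JY (at x) (JX x) - frechet_derivative JX (at x) (JY x))
    - K x (frechet_derivative Y (at x) (JX x) - frechet_derivative JX (at x) (Y x))
    - K x (frechet_derivative JY (at x) (X x) - frechet_derivative X (at x) (JY x))
    - (frechet_derivative Y (at x) (X x) - frechet_derivative X (at x) (Y x))
    = nijenhuis_coord x (X x) (Y x)"
proof -
  have "frechet_derivative JX (at x) = (\<lambda>w. dK x w (X x) + K x (frechet_derivative X (at x) w))"
    "frechet_derivative JY (at x) = (\<lambda>w. dK x w (Y x) + K x (frechet_derivative Y (at x) w))"
    unfolding JX_def JY_def
    by (rule frechet_derivative_at[OF has_derivative_K[OF x X], symmetric],
        rule frechet_derivative_at[OF has_derivative_K[OF x Y], symmetric])
  then show ?thesis
    by (simp add: JX_def JY_def nijenhuis_coord_def K_K[OF x]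
        linear_add[OF linear_K[OF x]] linear_diff[OF linear_K[OF x]])
qed

end

subsection \<open>Alternating antilinear maps in dimension four\<close>

text \<open>On the quotient by \<open>span B\<close> the map induced by \<open>K\<close> still
  squares to minus the identity, so it has no real eigenvalue.\<close>

lemma complex_image_notin_span:
  fixes K :: "'e::real_vector \<Rightarrow> 'e"
  assumes K: "linear K" "\<And>v. K (K v) = - v"
    and inv: "K ` span B \<subseteq> span B" and b: "b \<notin> span B"
  shows "K b \<notin> span (insert b B)"
proof
  assume "K b \<in> span (insert b B)"
  then obtain c where c: "K b - c *\<^sub>R b \<in> span B" by (auto simp: span_breakdown_eq)
  \<comment> \<open>This is \<open>(K + c) (K - c) = K\<^sup>2 - c\<^sup>2\<close> applied to
    \<open>b\<close>.\<close>
  have "K (K b - c *\<^sub>R b) + c *\<^sub>R (K b - c *\<^sub>R b) = - (1 + c\<^sup>2) *\<^sub>R b"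
    by (simp add: linear_diff[OF K(1)] linear_cmul[OF K(1)] K(2) algebra_simps power2_eq_square)
  moreover have "K (K b - c *\<^sub>R b) + c *\<^sub>R (K b - c *\<^sub>R b) \<in> span B"
    using c inv by (intro span_add span_scale) auto
  ultimately have "- (1 + c\<^sup>2) *\<^sub>R b \<in> span B" by simp
  moreover have "- (1 + c\<^sup>2) \<noteq> 0" using zero_le_power2[of c] by linarith
  ultimately have "b \<in> span B"
    using span_scale[of "- (1 + c\<^sup>2) *\<^sub>R b" B "inverse (- (1 + c\<^sup>2))"] by simp
  with b show False ..
qed

lemma complex_span_invariant:
  fixes K :: "'e::real_vector \<Rightarrow> 'e"
  assumes K: "linear K" "\<And>v. K (K v) = - v"
  shows "K ` span {a, K a} \<subseteq> span {a, K a}"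
proof -
  have "K ` {a, K a} \<subseteq> span {a, K a}"
    by (auto simp: K(2) span_base span_neg)
  then show ?thesis
    by (simp add: linear_span_image[OF K(1), symmetric] span_minimal subspace_span)
qed

text \<open>Choose \<open>a\<close> nonzero, then \<open>b\<close> outside the plane of
  \<open>a\<close> and \<open>K a\<close>, which cannot fill dimension 4. Each time
  \<open>complex_image_notin_span\<close> adds the image under \<open>K\<close>, and four
  independent vectors span.\<close>

lemma complex_basis_DIM_4:
  fixes K :: "'e::euclidean_space \<Rightarrow> 'e"
  assumes K: "linear K" "\<And>v. K (K v) = - v" and dim: "DIM('e) = 4"
  obtains a b where "span {a, K a, b, K b} = UNIV"
proof -
  obtain a :: 'e where a: "a \<noteq> 0" using nonempty_Basis nonzero_Basis by blast
  have Ka: "K a \<notin> span {a}"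
    by (rule complex_image_notin_span[OF K, of "{}"]) (use a linear_0[OF K(1)] in auto)
  then have "K a \<noteq> a" using span_base[of a "{a}"] by auto
  then have card: "card {a, K a} = 2" by simp
  have "independent {K a, a}"
    by (intro independent_insertI Ka) (simp_all add: a independent_empty)
  then have ind: "independent {a, K a}" by (simp add: insert_commute)
  have "dim (span {a, K a}) = 2"
    using dim_span_eq_card_independent[OF ind] card by (rule trans)
  then have "span {a, K a} \<noteq> UNIV" using dim by (auto simp del: dim_span)
  then obtain b where b: "b \<notin> span {a, K a}" by blast
  have Kb: "K b \<notin> span {b, a, K a}"
    by (rule complex_image_notin_span[OF K complex_span_invariant[OF K] b])
  have ne: "b \<notin> {a, K a}" "K b \<notin> {b, a, K a}"
    using b Kb span_base[of b "{a, K a}"] span_base[of "K b" "{b, a, K a}"] by auto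
  have "independent {K b, b, a, K a}"
    by (intro independent_insertI Kb b ind)
  moreover have "card {K b, b, a, K a} = 4"
    using card ne by simp
  ultimately have "UNIV \<subseteq> span {K b, b, a, K a}"
    by (intro card_ge_dim_independent) (simp_all add: dim)
  moreover have "{K b, b, a, K a} = {a, K a, b, K b}" by blast
  ultimately show thesis by (intro that[of a b]) auto
qed

text \<open>The witness is \<open>w = N a b\<close> for a basis \<open>a, K a, b, K b\<close>. On
  pairs of basis vectors \<open>N\<close> is zero or, up to sign, \<open>w\<close> or
  \<open>K w\<close>; for instance \<open>N a (K a) = - K (N a a) = 0\<close>.\<close>

lemma antilinear_alternating_image:
  fixes K :: "'e::euclidean_space \<Rightarrow> 'e" and N :: "'e \<Rightarrow> 'e \<Rightarrow> 'e"
  assumes K: "linear K" "\<And>v. K (K v) = - v" and dim: "DIM('e) = 4"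
    and N: "\<And>u. linear (N u)" "\<And>v. linear (\<lambda>u. N u v)"
    and self: "\<And>u. N u u = 0" and NK: "\<And>u v. N (K u) v = - K (N u v)"
  obtains w where "\<And>u v. N u v \<in> span {w, K w}"
proof -
  obtain a b where ab: "span {a, K a, b, K b} = UNIV"
    using complex_basis_DIM_4[OF K dim] .
  define T where "T = span {N a b, K (N a b)}"
  have T: "subspace T" by (simp add: T_def subspace_span)
  have KT: "K v \<in> T" if "v \<in> T" for v
    using complex_span_invariant[OF K] that by (auto simp: T_def)
  have alt: "N u v = - N v u" for u v
  proof -
    have "N u u + N v u + (N u v + N v v) = 0"
      using self[of "u + v"] by (simp only: linear_add[OF N(1)] linear_add[OF N(2)])
    then have "N u v + N v u = 0"
      by (simp add: self add.commute)
    then show ?thesis by (simp add: eq_neg_iff_add_eq_0)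
  qed
  \<comment> \<open>Alternation carries antilinearity over to the second argument.\<close>
  have NK': "N u (K v) = - K (N u v)" for u v
    by (metis NK alt K(1) linear_neg)
  \<comment> \<open>Membership in \<open>T\<close> need only be tested on the four basis vectors.
    This is applied to the second argument with \<open>a\<close> or \<open>b\<close> in the first,
    then to the first argument.\<close>
  have all: "P u" if "subspace {u. P u}" "P a" "P (K a)" "P b" "P (K b)" for P and u :: 'e
    using span_minimal[OF _ that(1), of "{a, K a, b, K b}"] that ab by auto
  have sub1: "subspace {v. N u v \<in> T}" for u
    using T linear_0[OF N(1)] linear_add[OF N(1)] linear_cmul[OF N(1)]
    unfolding subspace_def by auto
  have base: "N a b \<in> T" by (simp add: T_def span_base)
  have Na: "N a v \<in> T" for v
    using sub1[of a]
    by (rule all) (simp_all add: self NK' linear_0[OF K(1)] subspace_0[OF T] base KT subspace_neg[OF T])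
  have Nb: "N b v \<in> T" for v
    using sub1[of b]
    by (rule all) (simp_all add: self NK' alt[of b a] linear_0[OF K(1)] linear_neg[OF K(1)]
        subspace_0[OF T] base KT subspace_neg[OF T])
  have sub2: "subspace {u. N u v \<in> T}" for v
    using T linear_0[OF N(2)] linear_add[OF N(2)] linear_cmul[OF N(2)]
    unfolding subspace_def by auto
  have "N u v \<in> T" for u v
    using sub2[of v]
    by (rule all) (auto simp: Na Nb NK intro!: KT subspace_neg[OF T])
  then show thesis using that unfolding T_def by blast
qed

subsection \<open>Passing to charts\<close>

lemma scaleR_fun_apply: "(r *\<^sub>R f) x = r *\<^sub>R f x"
  by (simp add: scaleR_fun_def)

text \<open>On the image of the chart this is \<open>J\<close> conjugated by the isomorphism from
  tangent space to model space. The form repeats the smoothness condition of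
  \<open>almost_complex_structure\<close>, so smoothness in \<open>y\<close> for fixed
  \<open>e\<close> is immediate.\<close>

definition chart_endomorphism ::
    "('a, 'e::euclidean_space) chart set \<Rightarrow> ('a \<Rightarrow> ('a, 'e) tangent \<Rightarrow> ('a, 'e) tangent)
      \<Rightarrow> ('a, 'e) chart \<Rightarrow> 'e \<Rightarrow> 'e \<Rightarrow> 'e"
  where "chart_endomorphism A J c y e = field_rep c (\<lambda>p. J p (coord_vector A c e p)) y"

context smooth_manifold
begin

section \<open>Charts and transition maps\<close>

lemma inj_on_chart: "c \<in> A \<Longrightarrow> inj_on (snd c) (fst c)"
  using homeomorphic_imp_injective_map[OF homeomorphism] openin_subset[OF open_domain]
  by (metis topspace_subtopology_subset)

lemma chart_inv_chart: "c \<in> A \<Longrightarrow> p \<in> fst c \<Longrightarrow> chart_inv c (snd c p) = p"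
  by (simp add: chart_inv_def inv_into_f_f inj_on_chart)

lemma field_rep_chart: "c \<in> A \<Longrightarrow> p \<in> fst c \<Longrightarrow> field_rep c X (snd c p) = X p c"
  by (simp add: field_rep_def chart_inv_chart)

lemma transition_chart: "c \<in> A \<Longrightarrow> p \<in> fst c \<Longrightarrow> transition c d (snd c p) = snd d p"
  by (simp add: transition_def chart_inv_chart)

lemma open_chart_image:
  assumes c: "c \<in> A" and W: "openin M W"
  shows "open (snd c ` (fst c \<inter> W))"
proof -
  have "openin (top_of_set (snd c ` fst c)) (snd c ` (fst c \<inter> W))"
    using homeomorphic_imp_open_map[OF homeomorphism[OF c]] W
    by (simp add: open_map_def openin_subtopology_Int2)
  then show ?thesis
    by (simp add: openin_open_eq open_image[OF c])
qed

lemma transition_differentiable: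
  assumes "c \<in> A" "d \<in> A" "p \<in> fst c" "p \<in> fst d"
  shows "transition c d differentiable (at (snd c p))"
  by (rule smooth_on_differentiable[OF compatible open_chart_image])
    (use assms open_domain in auto)

lemmas linear_transition_derivative = linear_frechet_derivative[OF transition_differentiable]

lemma transition_derivative_self:
  assumes "c \<in> A" "p \<in> fst c"
  shows "frechet_derivative (transition c c) (at (snd c p)) v = v"
proof -
  have "frechet_derivative (transition c c) (at (snd c p)) = frechet_derivative (\<lambda>y. y) (at (snd c p))"
    by (rule frechet_derivative_cong_open[OF open_image[OF assms(1)]])
      (use assms in \<open>auto simp: transition_chart\<close>)
  then show ?thesis by (simp add: frechet_derivative_ident)
qed

text \<open>The chain rule. The maps themselves compose on the image of the overlap of
  \<open>c\<close> and \<open>d\<close>, an open set around \<open>snd c p\<close>, which is enough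
  for the derivatives.\<close>

lemma transition_derivative_cocycle:
  assumes c: "c \<in> A" "p \<in> fst c" and d: "d \<in> A" "p \<in> fst d" and b: "b \<in> A" "p \<in> fst b"
  shows "frechet_derivative (transition d b) (at (snd d p))
      (frechet_derivative (transition c d) (at (snd c p)) v)
    = frechet_derivative (transition c b) (at (snd c p)) v"
proof -
  have "(transition c d has_derivative frechet_derivative (transition c d) (at (snd c p))) (at (snd c p))"
    using transition_differentiable[OF c(1) d(1) c(2) d(2)] by (simp add: frechet_derivative_works)
  moreover have "(transition d b has_derivative frechet_derivative (transition d b) (at (snd d p)))
      (at (transition c d (snd c p)))"
    using transition_differentiable[OF d(1) b(1) d(2) b(2)]
    by (simp add: frechet_derivative_works transition_chart c)
  ultimately have "((\<lambda>y. transition d b (transition c d y)) has_derivative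
      (\<lambda>v. frechet_derivative (transition d b) (at (snd d p))
        (frechet_derivative (transition c d) (at (snd c p)) v))) (at (snd c p))"
    by (rule has_derivative_compose)
  then have "(transition c b has_derivative
      (\<lambda>v. frechet_derivative (transition d b) (at (snd d p))
        (frechet_derivative (transition c d) (at (snd c p)) v))) (at (snd c p))"
    by (rule has_derivative_transform_within_open[OF _ open_chart_image[OF c(1) open_domain[OF d(1)]]])
      (use c d in \<open>auto simp: transition_chart\<close>)
  from frechet_derivative_at[OF this] show ?thesis by (rule fun_cong)
qed

section \<open>Tangent vectors in a chart\<close>

lemma charts_atD: "c \<in> charts_at A p \<Longrightarrow> c \<in> A" "c \<in> charts_at A p \<Longrightarrow> p \<in> fst c"
  by (auto simp: charts_at_def)

lemma linear_coord_vector: "c \<in> charts_at A p \<Longrightarrow> linear (\<lambda>e. coord_vector A c e p)"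
  by (rule linearI) (auto simp: coord_vector_def fun_eq_iff scaleR_fun_apply charts_at_def
      linear_add[OF linear_transition_derivative] linear_cmul[OF linear_transition_derivative])

lemma coord_vector_tangent: "c \<in> charts_at A p \<Longrightarrow> coord_vector A c e p \<in> tangent_space A p"
  unfolding tangent_space_def mem_Collect_eq
  by (intro conjI ballI allI impI)
    (simp_all add: coord_vector_def transition_derivative_cocycle charts_atD)

lemma coord_vector_self: "c \<in> charts_at A p \<Longrightarrow> coord_vector A c e p c = e"
  by (simp add: coord_vector_def transition_derivative_self charts_atD)

text \<open>With \<open>coord_vector_self\<close> this makes \<open>coord_vector\<close> the inverse
  of evaluation at \<open>c\<close>, so that \<open>J\<close> and linear spans can be computed in a
  single chart.\<close>

lemma tangent_eq_coord_vector:
  assumes c: "c \<in> charts_at A p" and u: "u \<in> tangent_space A p"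
  shows "u = coord_vector A c (u c) p"
proof
  fix d
  show "u d = coord_vector A c (u c) p d"
  proof (cases "d \<in> charts_at A p")
    case True
    then have "u d = frechet_derivative (transition c d) (at (snd c p)) (u c)"
      using c u unfolding tangent_space_def by blast
    then show ?thesis using True by (simp only: coord_vector_def if_True)
  next
    case False
    then have "u d = 0" using u unfolding tangent_space_def by blast
    with False show ?thesis by (simp add: coord_vector_def)
  qed
qed

lemma subspace_tangent_space:
  assumes "c \<in> charts_at A p"
  shows "subspace (tangent_space A p)"
proof -
  have "tangent_space A p = range (\<lambda>e. coord_vector A c e p)"
    using tangent_eq_coord_vector[OF assms] coord_vector_tangent[OF assms] by blast
  then show ?thesis
    using linear_subspace_image[OF linear_coord_vector[OF assms] subspace_UNIV] by simp
qed

section \<open>Lie brackets\<close>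

text \<open>Tangency is assumed on a neighbourhood because the transformation law between charts
  gets differentiated in \<open>bracket_transform\<close>. The fields are only assumed
  differentiable at the point, which is the form in which \<open>J\<close> applied to a field is
  supplied later.\<close>

lemma lie_bracket_tangent:
  assumes W: "openin M W" "p \<in> W"
    and X: "\<And>q. q \<in> W \<Longrightarrow> X q \<in> tangent_space A q"
      "\<And>c. c \<in> charts_at A p \<Longrightarrow> field_rep c X differentiable (at (snd c p))"
    and Y: "\<And>q. q \<in> W \<Longrightarrow> Y q \<in> tangent_space A q"
      "\<And>c. c \<in> charts_at A p \<Longrightarrow> field_rep c Y differentiable (at (snd c p))"
  shows "lie_bracket A X Y p \<in> tangent_space A p"
proof -
  have "lie_bracket A X Y p d
      = frechet_derivative (transition c d) (at (snd c p)) (lie_bracket A X Y p c)"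
    if c: "c \<in> charts_at A p" and d: "d \<in> charts_at A p" for c d
  proof -
    note c' = charts_atD[OF c] and d' = charts_atD[OF d]
    define S where "S = snd c ` (fst c \<inter> (fst d \<inter> W))"
    have S: "open S" "snd c p \<in> S"
      using open_chart_image[OF c'(1), of "fst d \<inter> W"] open_domain[OF d'(1)] W c' d'
      by (auto simp: S_def)
    have smooth: "smooth_on (transition c d) S"
      by (rule smooth_on_subset[OF compatible[OF c'(1) d'(1)]]) (auto simp: S_def)
    have push: "field_rep d Z (transition c d y)
        = frechet_derivative (transition c d) (at y) (field_rep c Z y)"
      if Z: "\<And>q. q \<in> W \<Longrightarrow> Z q \<in> tangent_space A q" and "y \<in> S" for Z y
    proof -
      obtain q where q: "q \<in> fst c" "q \<in> fst d" "q \<in> W" "y = snd c q"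
        using \<open>y \<in> S\<close> by (auto simp: S_def)
      have "Z q d = frechet_derivative (transition c d) (at (snd c q)) (Z q c)"
        using Z[OF q(3)] q c' d' unfolding tangent_space_def charts_at_def by blast
      with q c' d' show ?thesis by (simp add: transition_chart field_rep_chart)
    qed
    have "frechet_derivative (field_rep d Y) (at (transition c d (snd c p))) (field_rep d X (transition c d (snd c p)))
        - frechet_derivative (field_rep d X) (at (transition c d (snd c p))) (field_rep d Y (transition c d (snd c p)))
        = frechet_derivative (transition c d) (at (snd c p))
          (frechet_derivative (field_rep c Y) (at (snd c p)) (field_rep c X (snd c p))
          - frechet_derivative (field_rep c X) (at (snd c p)) (field_rep c Y (snd c p)))"
      by (rule bracket_transform[OF smooth S])
        (use push[OF X(1)] push[OF Y(1)] X(2) Y(2) c d c' d' in \<open>auto simp: transition_chart\<close>)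
    then show ?thesis
      using c d c' d' by (simp add: lie_bracket_def transition_chart field_rep_chart)
  qed
  moreover have "lie_bracket A X Y p d = 0" if "d \<notin> charts_at A p" for d
    using that by (simp add: lie_bracket_def)
  ultimately show ?thesis unfolding tangent_space_def by blast
qed

section \<open>The almost complex structure and its Nijenhuis tensor in a chart\<close>

lemma almost_complex_structureD:
  assumes J: "almost_complex_structure M A J" and p: "p \<in> topspace M"
  shows "v \<in> tangent_space A p \<Longrightarrow> J p v \<in> tangent_space A p"
    and "u \<in> tangent_space A p \<Longrightarrow> v \<in> tangent_space A p \<Longrightarrow> J p (u + v) = J p u + J p v"
    and "v \<in> tangent_space A p \<Longrightarrow> J p (r *\<^sub>R v) = r *\<^sub>R J p v"
    and "v \<in> tangent_space A p \<Longrightarrow> J p (J p v) = - v"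
  using assms unfolding almost_complex_structure_def by blast+

lemma chart_endomorphism_eq:
  assumes "c \<in> charts_at A p" "u \<in> tangent_space A p"
  shows "J p u c = chart_endomorphism A J c (snd c p) (u c)"
  using tangent_eq_coord_vector[OF assms]
  by (simp add: chart_endomorphism_def field_rep_chart charts_atD[OF assms(1)])

lemma almost_complex_family_chart:
  assumes J: "almost_complex_structure M A J" and c: "c \<in> A"
  shows "almost_complex_family (chart_endomorphism A J c) (snd c ` fst c)"
proof (rule almost_complex_family.intro)
  show "open (snd c ` fst c)" by (rule open_image[OF c])
next
  fix y assume "y \<in> snd c ` fst c"
  then obtain p where p: "p \<in> fst c" "y = snd c p" by blast
  have cp: "c \<in> charts_at A p" using c p by (simp add: charts_at_def)
  have pM: "p \<in> topspace M" using c p covers by blast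
  note JD = almost_complex_structureD[OF J pM]
  note lin = linear_coord_vector[OF cp] and tan = coord_vector_tangent[OF cp]
  have eq: "chart_endomorphism A J c y v = J p (coord_vector A c v p) c" for v
    by (simp add: chart_endomorphism_def p field_rep_chart c)
  show "linear (chart_endomorphism A J c y)"
    by (rule linearI) (simp_all add: eq linear_add[OF lin] linear_cmul[OF lin] JD tan scaleR_fun_apply)
  \<comment> \<open>The inner \<open>J p\<close> yields a tangent vector, so reading its coordinates
    in \<open>c\<close> and lifting them again changes nothing.\<close>
  have "J p (coord_vector A c (J p (coord_vector A c v p) c) p) = - coord_vector A c v p" for v
    using tangent_eq_coord_vector[OF cp JD(1)[OF tan]] JD(4)[OF tan] by metis
  then show "chart_endomorphism A J c y (chart_endomorphism A J c y v) = - v" for v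
    by (simp add: eq coord_vector_self[OF cp])
  fix v
  have "smooth_on (\<lambda>y. chart_endomorphism A J c y v) (snd c ` fst c)"
    using J c by (simp add: almost_complex_structure_def chart_endomorphism_def)
  then show "(\<lambda>y. chart_endomorphism A J c y v) differentiable (at y)"
    by (rule smooth_on_differentiable[OF _ open_image[OF c]]) (use p in blast)
qed

text \<open>Once all four brackets are known to be tangent, \<open>J\<close> acts on them through
  its chart representation, and \<open>nijenhuis_coord_eq\<close> applies.\<close>

lemma nijenhuis_in_chart:
  assumes J: "almost_complex_structure M A J"
    and W: "openin M W" "p \<in> W" and X: "vector_field_on A W X" and Y: "vector_field_on A W Y"
  shows "nijenhuis A J X Y p \<in> tangent_space A p"
    and "c \<in> charts_at A p \<Longrightarrow> nijenhuis A J X Y p c =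
      almost_complex_family.nijenhuis_coord (chart_endomorphism A J c) (snd c p) (X p c) (Y p c)"
proof -
  define JX where "JX = (\<lambda>q. J q (X q))"
  define JY where "JY = (\<lambda>q. J q (Y q))"
  have WM: "W \<subseteq> topspace M" using W openin_subset by blast
  have tan: "Z q \<in> tangent_space A q" "J q (Z q) \<in> tangent_space A q"
    if "vector_field_on A W Z" "q \<in> W" for Z q
    using that WM almost_complex_structureD(1)[OF J] by (auto simp: vector_field_on_def)
  have diff: "field_rep c Z differentiable (at (snd c p))"
    if "vector_field_on A W Z" "c \<in> charts_at A p" for Z c
    using that W charts_atD[OF that(2)] open_chart_image[of c W]
    by (auto simp: vector_field_on_def intro!: smooth_on_differentiable[of _ "snd c ` (fst c \<inter> W)"])
  have rep: "field_rep c (\<lambda>q. J q (Z q)) y = chart_endomorphism A J c y (field_rep c Z y)"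
    if Z: "vector_field_on A W Z" and c: "c \<in> A" and y: "y \<in> snd c ` (fst c \<inter> W)" for Z c y
  proof -
    obtain q where "q \<in> fst c" "q \<in> W" "y = snd c q" using y by blast
    then show ?thesis
      using chart_endomorphism_eq[of c q "Z q" J] tan(1)[OF Z] c
      by (simp add: field_rep_chart charts_at_def)
  qed
  \<comment> \<open>The Leibniz rule gives the derivative of the chart expression, which agrees with
    the field near the point by \<open>rep\<close>.\<close>
  have diffJ: "field_rep c (\<lambda>q. J q (Z q)) differentiable (at (snd c p))"
    if Z: "vector_field_on A W Z" and c: "c \<in> charts_at A p" for Z c
  proof -
    note c' = charts_atD[OF c]
    interpret almost_complex_family "chart_endomorphism A J c" "snd c ` fst c"
      by (rule almost_complex_family_chart[OF J c'(1)])
    have "snd c p \<in> snd c ` fst c" using c' by blast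
    note has_derivative_K[OF this diff[OF Z c]]
    then have "(field_rep c (\<lambda>q. J q (Z q)) has_derivative
        (\<lambda>w. dK (snd c p) w (field_rep c Z (snd c p))
          + chart_endomorphism A J c (snd c p) (frechet_derivative (field_rep c Z) (at (snd c p)) w)))
        (at (snd c p))"
      by (rule has_derivative_transform_within_open[OF _ open_chart_image[OF c'(1) W(1)]])
        (use c' W rep[OF Z c'(1)] in auto)
    then show ?thesis by (rule differentiableI)
  qed
  note bracket = lie_bracket_tangent[OF W]
  have bJJ: "lie_bracket A JX JY p \<in> tangent_space A p"
    and bJ1: "lie_bracket A JX Y p \<in> tangent_space A p"
    and bJ2: "lie_bracket A X JY p \<in> tangent_space A p"
    and b: "lie_bracket A X Y p \<in> tangent_space A p"
    unfolding JX_def JY_def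
    by (rule bracket; use tan[OF X] tan[OF Y] diff[OF X] diff[OF Y] diffJ[OF X] diffJ[OF Y] in blast)+
  have pM: "p \<in> topspace M" using W WM by blast
  have N: "nijenhuis A J X Y p = lie_bracket A JX JY p - J p (lie_bracket A JX Y p)
      - J p (lie_bracket A X JY p) - lie_bracket A X Y p"
    by (simp add: nijenhuis_def JX_def JY_def Let_def)
  obtain d where d: "d \<in> charts_at A p"
    using pM covers unfolding charts_at_def by blast
  show "nijenhuis A J X Y p \<in> tangent_space A p"
    unfolding N using subspace_tangent_space[OF d]
    by (intro subspace_diff almost_complex_structureD(1)[OF J pM] bJJ bJ1 bJ2 b)
  assume c: "c \<in> charts_at A p"
  note c' = charts_atD[OF c]
  interpret almost_complex_family "chart_endomorphism A J c" "snd c ` fst c"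
    by (rule almost_complex_family_chart[OF J c'(1)])
  have y: "snd c p \<in> snd c ` fst c" using c' by blast
  have fdJ: "frechet_derivative (field_rep c (\<lambda>q. J q (Z q))) (at (snd c p))
      = frechet_derivative (\<lambda>y. chart_endomorphism A J c y (field_rep c Z y)) (at (snd c p))"
    if Z: "vector_field_on A W Z" for Z
    by (rule frechet_derivative_cong_open[OF open_chart_image[OF c'(1) W(1)]])
      (use c' W rep[OF Z c'(1)] in auto)
  have bc: "lie_bracket A U V p c = frechet_derivative (field_rep c V) (at (snd c p)) (U p c)
      - frechet_derivative (field_rep c U) (at (snd c p)) (V p c)" for U V
    using c by (simp add: lie_bracket_def)
  have Jc: "JX p c = chart_endomorphism A J c (snd c p) (X p c)"
    "JY p c = chart_endomorphism A J c (snd c p) (Y p c)"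
    unfolding JX_def JY_def using tan X Y W chart_endomorphism_eq[OF c] by blast+
  have "nijenhuis A J X Y p c = lie_bracket A JX JY p c
      - chart_endomorphism A J c (snd c p) (lie_bracket A JX Y p c)
      - chart_endomorphism A J c (snd c p) (lie_bracket A X JY p c) - lie_bracket A X Y p c"
    unfolding N using chart_endomorphism_eq[OF c bJ1, of J] chart_endomorphism_eq[OF c bJ2, of J] by simp
  also have "\<dots> = nijenhuis_coord (snd c p) (X p c) (Y p c)"
    using nijenhuis_coord_eq[OF y diff[OF X c] diff[OF Y c]]
    by (simp only: bc Jc field_rep_chart[OF c'] fdJ[OF X, folded JX_def] fdJ[OF Y, folded JY_def])
  finally show "nijenhuis A J X Y p c = nijenhuis_coord (snd c p) (X p c) (Y p c)" .
qed

text \<open>In one chart around \<open>x\<close> the values lie in the span of two vectors; lifting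
  these by \<open>coord_vector\<close> gives a finite set whose span contains the whole
  image.\<close>

lemma dim_nijenhuis_image_le_2:
  assumes dim: "DIM('e) = 4" and J: "almost_complex_structure M A J" and x: "x \<in> topspace M"
  shows "dim (nijenhuis_image M A J x) \<le> 2"
proof -
  obtain c where c: "c \<in> charts_at A x"
    using x covers unfolding charts_at_def by blast
  note c' = charts_atD[OF c]
  interpret almost_complex_family "chart_endomorphism A J c" "snd c ` fst c"
    by (rule almost_complex_family_chart[OF J c'(1)])
  have y: "snd c x \<in> snd c ` fst c" using c' by blast
  \<comment> \<open>The vector \<open>w\<close> is fixed by \<open>x\<close> and \<open>c\<close>
    before any fields are chosen, so one span serves for all \<open>X\<close>, \<open>Y\<close> and
    \<open>W\<close>.\<close>
  obtain w where w: "nijenhuis_coord (snd c x) u v \<in> span {w, chart_endomorphism A J c (snd c x) w}" for u v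
    by (rule antilinear_alternating_image[of "chart_endomorphism A J c (snd c x)"
          "nijenhuis_coord (snd c x)", OF linear_K[OF y] K_K[OF y] dim linear_nijenhuis_coord[OF y]
          nijenhuis_coord_self nijenhuis_coord_K[OF y]]) (rule that)
  define B where "B = {w, chart_endomorphism A J c (snd c x) w}"
  have "nijenhuis A J X Y x \<in> span ((\<lambda>e. coord_vector A c e x) ` B)"
    if "openin M W" "x \<in> W" "vector_field_on A W X" "vector_field_on A W Y" for X Y W
  proof -
    let ?N = "nijenhuis A J X Y x"
    have "?N c \<in> span B"
      unfolding nijenhuis_in_chart(2)[OF J that c] B_def by (rule w)
    then have "coord_vector A c (?N c) x \<in> (\<lambda>e. coord_vector A c e x) ` span B" by blast
    with tangent_eq_coord_vector[OF c nijenhuis_in_chart(1)[OF J that]] show ?thesis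
      by (simp add: linear_span_image[OF linear_coord_vector[OF c]])
  qed
  then have "nijenhuis_image M A J x \<subseteq> span ((\<lambda>e. coord_vector A c e x) ` B)"
    unfolding nijenhuis_image_def by (intro span_minimal subspace_span) auto
  then have "dim (nijenhuis_image M A J x) \<le> card ((\<lambda>e. coord_vector A c e x) ` B)"
    by (rule dim_le_card) (simp add: B_def)
  also have "\<dots> \<le> card B" by (rule card_image_le) (simp add: B_def)
  also have "\<dots> \<le> 2" by (simp add: B_def card_insert_if)
  finally show ?thesis .
qed

end

theorem proposition4p2:
  fixes M :: "'a topology"
    and A :: "('a, real^4) chart set"
    and J :: "'a \<Rightarrow> ('a, real^4) tangent \<Rightarrow> ('a, real^4) tangent"
  assumes "smooth_manifold M A"
    and "almost_complex_structure M A J"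
    and "x \<in> topspace M"
  shows "dim (nijenhuis_image M A J x) \<le> 2"
  by (rule smooth_manifold.dim_nijenhuis_image_le_2[OF assms(1) _ assms(2,3)]) simp

end
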